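(* Let $u:\mathbb{R}_+\to\mathbb{R}$ be a piecewise continuous function that is of persistent excitation (PE), with constants $T>0$ and $\epsilon>0$. Let $p>1$ and consider the scalar system ($n=1$) $$\dot{x}(t)=-\lceil u(t)x(t)\rfloor^{p}\,u(t),\qquad x(t)\in\mathbb{R}.$$ Then the origin $x=0$ is globally uniformly asymptotically stable. Furthermore, with $V(x)=\frac12 x^2$, for every $c>0$ the time $\tau(c)$ needed to escape from infinity to the compact region $\{x: V(x)\le c\}$ is bounded by $$\tau(c)\le\left\lceil \frac{1}{2^{\frac{p-1}{2}}(p-1)\,T\,\epsilon^{p+1}}\cdot\frac{1}{c^{\frac{p-1}{2}}}\right\rceil\cdot T ,$$ that is, for every initial time $t_0\ge0$ and every initial value $x(t_0)\in\mathbb{R}$, no matter how large, the trajectory reaches $\{V\le c\}$ within a time after $t_0$ not exceeding the right-hand side. Here $\lceil\cdot\rceil$ denotes the ceiling function.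
   Context: Notation: for $w\in\mathbb{R}$ and an exponent $p\ge 0$, $\lceil w\rfloor^p:=|w|^p\,\mathrm{sign}(w)$, with $\mathrm{sign}(0)=0$ (this is different from the ceiling function $\lceil\cdot\rceil$). Solutions are absolutely continuous functions satisfying the differential equation for almost every $t\ge t_0$. Persistent excitation (PE): a piecewise continuous $u:\mathbb{R}_+\to\mathbb{R}^n$ is of PE if there exist $T>0$ and $\epsilon>0$ such that $\frac{1}{T}\int_{t}^{t+T}|u^T(s)w|\,ds\ge\epsilon$ for all $t\ge 0$ and all $w\in\mathbb{R}^n$ with $\|w\|=1$. For $n=1$ this reads $\frac1T\int_t^{t+T}|u(s)|\,ds\ge\epsilon$ for all $t\ge 0$. "Uniformly" in asymptotic stability means uniformly in the initial time $t_0\ge 0$. *)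

theory Defs
  imports "HOL-Analysis.Analysis"
begin

definition spow :: "real \<Rightarrow> real \<Rightarrow> real" where
  "spow w p = \<bar>w\<bar> powr p * sgn w"

text \<open>Signals on the nonnegative half-line are total functions on the reals; only their values at
  times \<open>t \<ge> 0\<close> matter. Piecewise continuity has the usual meaning: finitely many discontinuities in
  each bounded interval, with finite one-sided limits at all of them (at points of continuity the
  limits exist anyway).\<close>

definition piecewise_continuous :: "(real \<Rightarrow> 'a::topological_space) \<Rightarrow> bool" where
  "piecewise_continuous u \<longleftrightarrow>
     (\<forall>b. finite {t \<in> {0..b}. \<not> continuous (at t within {0..}) u}) \<and>
     (\<forall>t\<ge>0. \<exists>l. (u \<longlongrightarrow> l) (at_right t)) \<and>
     (\<forall>t>0. \<exists>l. (u \<longlongrightarrow> l) (at_left t))"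

definition persistently_exciting :: "real \<Rightarrow> real \<Rightarrow> (real \<Rightarrow> 'a::euclidean_space) \<Rightarrow> bool" where
  "persistently_exciting T \<epsilon> u \<longleftrightarrow> T > 0 \<and> \<epsilon> > 0 \<and>
     (\<forall>t\<ge>0. \<forall>w. norm w = 1 \<longrightarrow> 1 / T * integral {t..t + T} (\<lambda>s. \<bar>u s \<bullet> w\<bar>) \<ge> \<epsilon>)"

text \<open>Absolute continuity of a function on \<open>{a..b}\<close> (the library's \<open>absolutely_continuous\<close> is the
  notion for measures).\<close>

definition abs_cont_on :: "real \<Rightarrow> real \<Rightarrow> (real \<Rightarrow> 'a::real_normed_vector) \<Rightarrow> bool" where
  "abs_cont_on a b x \<longleftrightarrow>
     (\<forall>e>0. \<exists>d>0. \<forall>(n::nat) l r.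
        (\<forall>i<n. a \<le> l i \<and> l i \<le> r i \<and> r i \<le> b) \<and>
        disjoint_family_on (\<lambda>i. {l i<..<r i}) {..<n} \<and>
        (\<Sum>i<n. r i - l i) < d
        \<longrightarrow> (\<Sum>i<n. norm (x (r i) - x (l i))) < e)"

text \<open>Solutions of \<open>x' = f t x\<close> on an interval \<open>I\<close>; on a non-compact interval absolute continuity is
  understood locally, that is, on each compact subinterval.\<close>

definition is_solution ::
  "(real \<Rightarrow> 'a::real_normed_vector \<Rightarrow> 'a) \<Rightarrow> real set \<Rightarrow> (real \<Rightarrow> 'a) \<Rightarrow> bool" where
  "is_solution f I x \<longleftrightarrow>
     (\<forall>a b. a \<le> b \<and> {a..b} \<subseteq> I \<longrightarrow> abs_cont_on a b x) \<and>
     (AE t in lebesgue. t \<in> I \<longrightarrow> (x has_vector_derivative f t (x t)) (at t within I))"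

text \<open>A solution exists for all initial data, and no solution stops existing in finite time. This
  makes it legitimate to quantify only over solutions on \<open>{t0..}\<close> below: none is missed, and the
  quantification is not vacuous.\<close>

definition forward_complete :: "(real \<Rightarrow> 'a::real_normed_vector \<Rightarrow> 'a) \<Rightarrow> bool" where
  "forward_complete f \<longleftrightarrow>
     (\<forall>t0\<ge>0. \<forall>x0. \<exists>x. is_solution f {t0..} x \<and> x t0 = x0) \<and>
     (\<forall>t0\<ge>0. \<forall>b>t0. \<forall>x. is_solution f {t0..<b} x \<longrightarrow>
        (\<exists>y. is_solution f {t0..} y \<and> (\<forall>t\<in>{t0..<b}. y t = x t)))"

text \<open>In the following three properties the constants \<open>d\<close>, \<open>R\<close>, \<open>S\<close> do not depend on the initial
  time \<open>t0\<close>.\<close>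

definition uniformly_stable :: "(real \<Rightarrow> 'a::real_normed_vector \<Rightarrow> 'a) \<Rightarrow> bool" where
  "uniformly_stable f \<longleftrightarrow>
     (\<forall>e>0. \<exists>d>0. \<forall>t0\<ge>0. \<forall>x. is_solution f {t0..} x \<and> norm (x t0) < d \<longrightarrow>
        (\<forall>t\<ge>t0. norm (x t) < e))"

definition uniformly_bounded :: "(real \<Rightarrow> 'a::real_normed_vector \<Rightarrow> 'a) \<Rightarrow> bool" where
  "uniformly_bounded f \<longleftrightarrow>
     (\<forall>r>0. \<exists>R>0. \<forall>t0\<ge>0. \<forall>x. is_solution f {t0..} x \<and> norm (x t0) < r \<longrightarrow>
        (\<forall>t\<ge>t0. norm (x t) < R))"

definition uniformly_globally_attractive :: "(real \<Rightarrow> 'a::real_normed_vector \<Rightarrow> 'a) \<Rightarrow> bool" where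
  "uniformly_globally_attractive f \<longleftrightarrow>
     (\<forall>r>0. \<forall>e>0. \<exists>S\<ge>0. \<forall>t0\<ge>0. \<forall>x. is_solution f {t0..} x \<and> norm (x t0) < r \<longrightarrow>
        (\<forall>t\<ge>t0 + S. norm (x t) < e))"

definition globally_uniformly_asymptotically_stable ::
  "(real \<Rightarrow> 'a::real_normed_vector \<Rightarrow> 'a) \<Rightarrow> bool" where
  "globally_uniformly_asymptotically_stable f \<longleftrightarrow>
     forward_complete f \<and> uniformly_stable f \<and> uniformly_bounded f \<and>
     uniformly_globally_attractive f"

definition V :: "real \<Rightarrow> real" where
  "V x = 1 / 2 * x\<^sup>2"

end

theory Submission
  imports Defs
begin

text \<open>The right-hand side is nonincreasing in \<open>x\<close>, so the squared difference of two solutions is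
  nonincreasing and solutions are determined by their initial values; since solutions are only
  absolutely continuous, this needs the fundamental theorem of calculus for absolutely continuous
  functions. Separation of variables gives
  \<open>\<bar>x t\<bar> powr (1 - p) = \<bar>x t0\<bar> powr (1 - p) + (p - 1) * (\<integral> \<bar>u\<bar> powr (p + 1))\<close>,
  the integral being taken from \<open>t0\<close> to \<open>t\<close>. By Jensen's inequality it grows by at least
  \<open>T * \<epsilon> powr (p + 1)\<close> over each period of length \<open>T\<close>. As \<open>p > 1\<close>, this bounds \<open>\<bar>x t\<bar>\<close> from
  above independently of \<open>x t0\<close>.\<close>

section \<open>Absolutely continuous functions\<close>

text \<open>Enumerating the index set along a bijection frees the definition from its indices
  \<open>{..<n}\<close>. The intervals of a tagged division, or a single interval, can then serve as
  the family directly.\<close>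

lemma abs_cont_on_finite_index:
  fixes x :: "real \<Rightarrow> 'a::real_normed_vector"
  assumes "abs_cont_on a b x" "e > 0"
  shows "\<exists>d>0. \<forall>(I :: 'i set) l r. finite I \<and> (\<forall>i\<in>I. a \<le> l i \<and> l i \<le> r i \<and> r i \<le> b) \<and>
     disjoint_family_on (\<lambda>i. {l i<..<r i}) I \<and> (\<Sum>i\<in>I. r i - l i) < d \<longrightarrow>
     (\<Sum>i\<in>I. norm (x (r i) - x (l i))) < e"
proof -
  obtain d where "d > 0" and
    d: "\<forall>(n::nat) l r. (\<forall>i<n. a \<le> l i \<and> l i \<le> r i \<and> r i \<le> b) \<and>
        disjoint_family_on (\<lambda>i. {l i<..<r i}) {..<n} \<and>
        (\<Sum>i<n. r i - l i) < d \<longrightarrow> (\<Sum>i<n. norm (x (r i) - x (l i))) < e"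
    using assms(1)[unfolded abs_cont_on_def, THEN spec, THEN mp, OF assms(2)] by blast
  have "(\<Sum>i\<in>I. norm (x (r i) - x (l i))) < e"
    if I: "finite I" "\<forall>i\<in>I. a \<le> l i \<and> l i \<le> r i \<and> r i \<le> b"
      "disjoint_family_on (\<lambda>i. {l i<..<r i}) I" "(\<Sum>i\<in>I. r i - l i) < d" for I :: "'i set" and l r
  proof -
    obtain h where h: "bij_betw h {..<card I} I"
      using ex_bij_betw_nat_finite[OF I(1)] by (auto simp: atLeast0LessThan)
    have "(\<Sum>i<card I. norm (x ((r \<circ> h) i) - x ((l \<circ> h) i))) < e"
    proof (rule d[rule_format], intro conjI)
      show "\<forall>i<card I. a \<le> (l \<circ> h) i \<and> (l \<circ> h) i \<le> (r \<circ> h) i \<and> (r \<circ> h) i \<le> b"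
        using I(2) h by (auto simp: bij_betw_def)
      show "disjoint_family_on (\<lambda>i. {(l \<circ> h) i<..<(r \<circ> h) i}) {..<card I}"
        unfolding disjoint_family_on_def
      proof (intro ballI impI)
        fix m n assume mn: "m \<in> {..<card I}" "n \<in> {..<card I}" "m \<noteq> n"
        then have "h m \<in> I" "h n \<in> I" "h m \<noteq> h n"
          using h by (auto simp: bij_betw_def inj_on_def)
        then show "{(l \<circ> h) m<..<(r \<circ> h) m} \<inter> {(l \<circ> h) n<..<(r \<circ> h) n} = {}"
          using I(3) unfolding disjoint_family_on_def o_apply by blast
      qed
      show "(\<Sum>i<card I. (r \<circ> h) i - (l \<circ> h) i) < d"
        using I(4) sum.reindex_bij_betw[OF h, of "\<lambda>i. r i - l i"] by simp
    qed
    then show ?thesis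
      using sum.reindex_bij_betw[OF h, of "\<lambda>i. norm (x (r i) - x (l i))"] by simp
  qed
  with \<open>d > 0\<close> show ?thesis by blast
qed

text \<open>The intervals of a fine tagged division whose tags lie in the exceptional null set have
  arbitrarily small total length, so absolute continuity makes their contribution small; the
  other intervals are controlled by the derivative at the tag, as in the everywhere
  differentiable case.\<close>

theorem abs_cont_on_fundamental_theorem_of_calculus:
  fixes f :: "real \<Rightarrow> 'a::banach"
  assumes "a \<le> b" and ac: "abs_cont_on a b f" and N: "negligible N"
    and der: "\<And>x. x \<in> {a..b} - N \<Longrightarrow> (f has_vector_derivative f' x) (at x within {a..b})"
  shows "(f' has_integral (f b - f a)) {a..b}"
proof (rule has_integral_spike[OF N])
  \<comment> \<open>With the integrand set to 0 on \<open>N\<close>, a Riemann term with tag in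
    \<open>N\<close> leaves only the increment of \<open>f\<close>.\<close>
  define g where "g x = (if x \<in> N then 0 else f' x)" for x
  show "f' x = g x" if "x \<in> {a..b} - N" for x
    using that by (simp add: g_def)
  show "(g has_integral (f b - f a)) {a..b}"
    unfolding has_integral_real
  proof (intro allI impI)
    fix e :: real assume "e > 0"
    \<comment> \<open>The summand 1 covers \<open>a = b\<close> and makes the second bound on
      \<open>e1\<close> strict.\<close>
    define e1 where "e1 = e / (2 * (b - a + 1))"
    have e1: "e1 > 0" "e1 * (b - a) < e / 2"
      using \<open>e > 0\<close> \<open>a \<le> b\<close> by (auto simp: e1_def field_simps)
    obtain \<delta> where "\<delta> > 0" and
      \<delta>: "\<forall>(I :: (real \<times> real set) set) l r.
         finite I \<and> (\<forall>i\<in>I. a \<le> l i \<and> l i \<le> r i \<and> r i \<le> b) \<and>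
         disjoint_family_on (\<lambda>i. {l i<..<r i}) I \<and> (\<Sum>i\<in>I. r i - l i) < \<delta> \<longrightarrow>
         (\<Sum>i\<in>I. norm (f (r i) - f (l i))) < e / 2"
      using abs_cont_on_finite_index[OF ac half_gt_zero[OF \<open>e > 0\<close>]] by blast
    obtain W where W: "open W" "N \<subseteq> W" "emeasure lebesgue W < ennreal \<delta>"
    proof -
      have null: "N \<in> null_sets lebesgue" using N negligible_iff_null_sets by blast
      obtain W where W: "open W" "N \<subseteq> W" "W - N \<in> lmeasurable" "emeasure lebesgue (W - N) < ennreal \<delta>"
        using sets_lebesgue_outer_open[OF _ \<open>\<delta> > 0\<close>, of N] null by (auto simp: null_sets_def)
      have "emeasure lebesgue (W - N) = emeasure lebesgue W"
        by (rule emeasure_Diff_null_set[OF null]) (simp add: W)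
      with W that show thesis by metis
    qed
    \<comment> \<open>One gauge serves both kinds of tags: balls around exceptional points stay
      inside the small open set \<open>W\<close>, and elsewhere the radius comes from the
      derivative. Points outside both sets impose no condition.\<close>
    have "\<exists>d>0. (x \<in> N \<longrightarrow> ball x d \<subseteq> W) \<and>
        (x \<in> {a..b} - N \<longrightarrow> (\<forall>y\<in>{a..b}. norm (y - x) < d \<longrightarrow>
           norm (f y - f x - (y - x) *\<^sub>R f' x) \<le> e1 * norm (y - x)))" for x
    proof (cases "x \<in> N")
      case True
      then show ?thesis using W(1,2) by (auto simp: open_contains_ball)
    next
      case False
      then show ?thesis
        using der[of x] \<open>e1 > 0\<close>
        unfolding has_vector_derivative_def has_derivative_within_alt
        by (cases "x \<in> {a..b}") (auto intro: zero_less_one)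
    qed
    then obtain d where d: "\<And>x. d x > 0" "\<And>x. x \<in> N \<Longrightarrow> ball x (d x) \<subseteq> W"
      "\<And>x y. \<lbrakk>x \<in> {a..b} - N; y \<in> {a..b}; norm (y - x) < d x\<rbrakk> \<Longrightarrow>
         norm (f y - f x - (y - x) *\<^sub>R f' x) \<le> e1 * norm (y - x)"
      by metis
    show "\<exists>\<gamma>. gauge \<gamma> \<and> (\<forall>\<D>. \<D> tagged_division_of {a..b} \<and> \<gamma> fine \<D> \<longrightarrow>
        norm ((\<Sum>(x, k)\<in>\<D>. measure lborel k *\<^sub>R g x) - (f b - f a)) < e)"
    proof (intro exI conjI allI impI; (elim conjE)?)
      show "gauge (\<lambda>x. ball x (d x))"
        using d(1) gauge_ball_dependent by blast
      fix p assume p: "p tagged_division_of {a..b}" and fine: "(\<lambda>x. ball x (d x)) fine p"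
      have K: "x \<in> K" "K = {Inf K..Sup K}" "a \<le> Inf K" "Inf K \<le> Sup K" "Sup K \<le> b"
        "measure lborel K = Sup K - Inf K" "K \<subseteq> ball x (d x)" if xK: "(x, K) \<in> p" for x K
      proof -
        obtain l r where lr: "K = cbox l r" and x: "x \<in> K" "K \<subseteq> {a..b}"
          using tagged_division_ofD(2,3,4)[OF p xK] by blast
        then have "l \<le> r" by auto
        then show "x \<in> K" "K = {Inf K..Sup K}" "a \<le> Inf K" "Inf K \<le> Sup K" "Sup K \<le> b"
          "measure lborel K = Sup K - Inf K"
          using x lr by auto
        show "K \<subseteq> ball x (d x)"
          using fine xK by (auto simp: fine_def)
      qed
      define q where "q = {xK \<in> p. fst xK \<in> N}"
      have fin: "finite p" using p by blast
      have q: "q \<subseteq> p" "finite q" using fin by (auto simp: q_def)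
      \<comment> \<open>The local error on one piece: Riemann term minus the increment of
        \<open>f\<close>. The increments telescope to \<open>f b - f a\<close>.\<close>
      define F where "F = (\<lambda>(x :: real, K :: real set). measure lborel K *\<^sub>R g x - (f (Sup K) - f (Inf K)))"
      have Fq: "norm (\<Sum>z\<in>q. F z) < e / 2"
      proof -
        define l where "l z = Inf (snd z :: real set)" for z :: "real \<times> real set"
        define r where "r z = Sup (snd z :: real set)" for z :: "real \<times> real set"
        have disj: "disjoint_family_on (\<lambda>z. {l z<..<r z}) q"
          unfolding disjoint_family_on_def
        proof (intro ballI impI)
          fix z w assume zw: "z \<in> q" "w \<in> q" "z \<noteq> w"
          then have "interior (snd z) \<inter> interior (snd w) = {}"
            using tagged_division_ofD(5)[OF p, of "fst z" "snd z" "fst w" "snd w"] q(1) by auto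
          moreover have "snd v = {l v..r v}" if "v \<in> q" for v
            using K(2)[of "fst v" "snd v"] that q(1) by (auto simp: l_def r_def)
          ultimately show "{l z<..<r z} \<inter> {l w<..<r w} = {}"
            using zw by (metis interior_atLeastAtMost_real)
        qed
        have lr: "a \<le> l z \<and> l z \<le> r z \<and> r z \<le> b" "{l z<..<r z} \<subseteq> W" if "z \<in> q" for z
        proof -
          from that have z: "(fst z, snd z) \<in> p" and "fst z \<in> N" by (auto simp: q_def)
          then show "a \<le> l z \<and> l z \<le> r z \<and> r z \<le> b"
            using K(3-5)[OF z] by (auto simp: l_def r_def)
          have "{l z<..<r z} \<subseteq> snd z"
            using K(2)[OF z] unfolding l_def r_def
            by (metis greaterThanLessThan_subseteq_atLeastAtMost_iff order_refl)
          also have "\<dots> \<subseteq> W"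
            using K(7)[OF z] d(2)[OF \<open>fst z \<in> N\<close>] by blast
          finally show "{l z<..<r z} \<subseteq> W" .
        qed
        \<comment> \<open>The pieces have disjoint interiors inside \<open>W\<close>, so their total
          length is below \<delta> and absolute continuity applies.\<close>
        have "ennreal (\<Sum>z\<in>q. r z - l z) = (\<Sum>z\<in>q. emeasure lebesgue {l z<..<r z})"
          using lr(1) by (subst sum_ennreal[symmetric]) auto
        also have "\<dots> = emeasure lebesgue (\<Union>z\<in>q. {l z<..<r z})"
          by (rule sum_emeasure) (use disj q in auto)
        also have "\<dots> \<le> emeasure lebesgue W"
          by (rule emeasure_mono) (use lr(2) W in auto)
        also have "\<dots> < ennreal \<delta>" by fact
        finally have "(\<Sum>z\<in>q. r z - l z) < \<delta>"
          using \<open>\<delta> > 0\<close> by (simp add: ennreal_less_iff sum_nonneg lr(1))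
        then have "(\<Sum>z\<in>q. norm (f (r z) - f (l z))) < e / 2"
          by (intro \<delta>[rule_format] conjI ballI q(2) lr(1) disj) auto
        moreover have "norm (F z) = norm (f (r z) - f (l z))" if "z \<in> q" for z
          using that by (cases z) (auto simp: F_def g_def q_def l_def r_def norm_minus_commute)
        ultimately show ?thesis
          using norm_sum[of F q] by simp
      qed
      have Fpq: "norm (\<Sum>z\<in>p - q. F z) \<le> e1 * (b - a)"
      proof -
        have "norm (\<Sum>z\<in>p - q. F z) \<le> (\<Sum>z\<in>p - q. e1 * measure lborel (snd z))"
        proof (rule sum_norm_le)
          fix z assume "z \<in> p - q"
          then obtain x K where z: "z = (x, K)" and xK: "(x, K) \<in> p" and "x \<notin> N"
            by (cases z) (auto simp: q_def)
          note K = K[OF xK]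
          have x: "Inf K \<le> x" "x \<le> Sup K" using K(1,2) by (metis atLeastAtMost_iff)+
          then have xN: "x \<in> {a..b} - N" using K \<open>x \<notin> N\<close> by auto
          have "Inf K \<in> K" "Sup K \<in> K" using K(2,4) by (metis atLeastAtMost_iff order_refl)+
          then have near: "norm (Inf K - x) < d x" "norm (Sup K - x) < d x"
            using K(7) by (auto simp: dist_norm norm_minus_commute subset_iff)
          \<comment> \<open>Both endpoints are compared with the tag. As the tag lies between them,
            the two distances add up to the length of \<open>K\<close>.\<close>
          have "F z = (f (Inf K) - f x - (Inf K - x) *\<^sub>R f' x) - (f (Sup K) - f x - (Sup K - x) *\<^sub>R f' x)"
            using \<open>x \<notin> N\<close> by (simp add: F_def z g_def K(6) algebra_simps)
          also have "norm \<dots> \<le> e1 * norm (Inf K - x) + e1 * norm (Sup K - x)"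
            by (rule order_trans[OF norm_triangle_ineq4 add_mono])
               (rule d(3)[OF xN]; use K near in auto)+
          also have "\<dots> = e1 * measure lborel (snd z)"
            using x by (simp add: z K(6) algebra_simps)
          finally show "norm (F z) \<le> e1 * measure lborel (snd z)" .
        qed
        also have "\<dots> \<le> (\<Sum>z\<in>p. e1 * measure lborel (snd z))"
          by (rule sum_mono2) (use fin \<open>e1 > 0\<close> in auto)
        also have "\<dots> = e1 * (b - a)"
          using additive_content_tagged_division[of p a b] p \<open>a \<le> b\<close>
          by (simp add: sum_distrib_left[symmetric] split_def)
        finally show ?thesis .
      qed
      have "(\<Sum>(x, k)\<in>p. measure lborel k *\<^sub>R g x) - (f b - f a) = (\<Sum>z\<in>p. F z)"
        using additive_tagged_division_1[OF \<open>a \<le> b\<close> p, of f]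
        by (simp add: F_def split_def sum_subtractf)
      also have "\<dots> = (\<Sum>z\<in>p - q. F z) + (\<Sum>z\<in>q. F z)"
        using sum.subset_diff[OF q(1) fin] .
      also have "norm \<dots> < e"
        using norm_triangle_ineq[of "\<Sum>z\<in>p - q. F z" "\<Sum>z\<in>q. F z"] Fq Fpq e1(2) by linarith
      finally show "norm ((\<Sum>(x, k)\<in>p. measure lborel k *\<^sub>R g x) - (f b - f a)) < e" .
    qed
  qed
qed

section \<open>Closure properties of absolute continuity\<close>

lemma lipschitz_on_abs_cont_on_compose:
  fixes x :: "real \<Rightarrow> 'a::real_normed_vector" and \<phi> :: "'a \<Rightarrow> 'b::real_normed_vector"
  assumes "abs_cont_on a b x" "L-lipschitz_on S \<phi>" "x ` {a..b} \<subseteq> S"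
  shows "abs_cont_on a b (\<lambda>t. \<phi> (x t))"
  unfolding abs_cont_on_def
proof (intro allI impI)
  fix e :: real assume "e > 0"
  have "L \<ge> 0" using assms(2) by (rule lipschitz_on_nonneg)
  \<comment> \<open>Dividing by \<open>L + 1\<close> instead of \<open>L\<close> covers
    \<open>L = 0\<close>.\<close>
  then have "e / (L + 1) > 0" using \<open>e > 0\<close> by simp
  then obtain d where "d > 0" and
    d: "\<forall>(n::nat) l r. (\<forall>i<n. a \<le> l i \<and> l i \<le> r i \<and> r i \<le> b) \<and>
        disjoint_family_on (\<lambda>i. {l i<..<r i}) {..<n} \<and> (\<Sum>i<n. r i - l i) < d \<longrightarrow>
        (\<Sum>i<n. norm (x (r i) - x (l i))) < e / (L + 1)"
    using assms(1)[unfolded abs_cont_on_def, THEN spec, THEN mp, OF \<open>e / (L + 1) > 0\<close>] by blast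
  show "\<exists>d>0. \<forall>(n::nat) l r. (\<forall>i<n. a \<le> l i \<and> l i \<le> r i \<and> r i \<le> b) \<and>
        disjoint_family_on (\<lambda>i. {l i<..<r i}) {..<n} \<and> (\<Sum>i<n. r i - l i) < d \<longrightarrow>
        (\<Sum>i<n. norm (\<phi> (x (r i)) - \<phi> (x (l i)))) < e"
  proof (intro exI conjI allI impI)
    fix n :: nat and l r :: "nat \<Rightarrow> real"
    assume A: "(\<forall>i<n. a \<le> l i \<and> l i \<le> r i \<and> r i \<le> b) \<and>
        disjoint_family_on (\<lambda>i. {l i<..<r i}) {..<n} \<and> (\<Sum>i<n. r i - l i) < d"
    have "(\<Sum>i<n. norm (\<phi> (x (r i)) - \<phi> (x (l i)))) \<le> (\<Sum>i<n. L * norm (x (r i) - x (l i)))"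
    proof (rule sum_mono)
      fix i assume "i \<in> {..<n}"
      then have "x (r i) \<in> S" "x (l i) \<in> S" using A assms(3) by force+
      then show "norm (\<phi> (x (r i)) - \<phi> (x (l i))) \<le> L * norm (x (r i) - x (l i))"
        using lipschitz_onD[OF assms(2)] by (metis dist_norm)
    qed
    also have "\<dots> = L * (\<Sum>i<n. norm (x (r i) - x (l i)))"
      by (simp add: sum_distrib_left)
    also have "\<dots> \<le> (L + 1) * (\<Sum>i<n. norm (x (r i) - x (l i)))"
      by (rule mult_right_mono) (auto intro: sum_nonneg)
    also have "\<dots> < e"
      using d[rule_format, of n l r] A \<open>L \<ge> 0\<close> by (simp add: field_simps)
    finally show "(\<Sum>i<n. norm (\<phi> (x (r i)) - \<phi> (x (l i)))) < e" .
  qed fact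
qed

text \<open>A Lipschitz function is its own composition with the identity, which is absolutely
  continuous.\<close>

lemma lipschitz_on_imp_abs_cont_on:
  fixes x :: "real \<Rightarrow> 'a::real_normed_vector"
  assumes "L-lipschitz_on {a..b} x"
  shows "abs_cont_on a b x"
proof -
  have "abs_cont_on a b (\<lambda>t::real. t)"
    unfolding abs_cont_on_def by auto
  from lipschitz_on_abs_cont_on_compose[OF this assms] show ?thesis by simp
qed

lemma abs_cont_on_diff:
  fixes x y :: "real \<Rightarrow> 'a::real_normed_vector"
  assumes "abs_cont_on a b x" "abs_cont_on a b y"
  shows "abs_cont_on a b (\<lambda>t. x t - y t)"
  unfolding abs_cont_on_def
proof (intro allI impI)
  fix e :: real assume "e > 0"
  then have "e / 2 > 0" by simp
  obtain d1 where "d1 > 0" and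
    d1: "\<forall>(n::nat) l r. (\<forall>i<n. a \<le> l i \<and> l i \<le> r i \<and> r i \<le> b) \<and>
        disjoint_family_on (\<lambda>i. {l i<..<r i}) {..<n} \<and> (\<Sum>i<n. r i - l i) < d1 \<longrightarrow>
        (\<Sum>i<n. norm (x (r i) - x (l i))) < e / 2"
    using assms(1)[unfolded abs_cont_on_def, THEN spec, THEN mp, OF \<open>e / 2 > 0\<close>] by blast
  obtain d2 where "d2 > 0" and
    d2: "\<forall>(n::nat) l r. (\<forall>i<n. a \<le> l i \<and> l i \<le> r i \<and> r i \<le> b) \<and>
        disjoint_family_on (\<lambda>i. {l i<..<r i}) {..<n} \<and> (\<Sum>i<n. r i - l i) < d2 \<longrightarrow>
        (\<Sum>i<n. norm (y (r i) - y (l i))) < e / 2"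
    using assms(2)[unfolded abs_cont_on_def, THEN spec, THEN mp, OF \<open>e / 2 > 0\<close>] by blast
  show "\<exists>d>0. \<forall>(n::nat) l r. (\<forall>i<n. a \<le> l i \<and> l i \<le> r i \<and> r i \<le> b) \<and>
        disjoint_family_on (\<lambda>i. {l i<..<r i}) {..<n} \<and> (\<Sum>i<n. r i - l i) < d \<longrightarrow>
        (\<Sum>i<n. norm (x (r i) - y (r i) - (x (l i) - y (l i)))) < e"
  proof (intro exI conjI allI impI)
    show "min d1 d2 > 0" using \<open>d1 > 0\<close> \<open>d2 > 0\<close> by simp
    fix n :: nat and l r :: "nat \<Rightarrow> real"
    assume A: "(\<forall>i<n. a \<le> l i \<and> l i \<le> r i \<and> r i \<le> b) \<and>
        disjoint_family_on (\<lambda>i. {l i<..<r i}) {..<n} \<and> (\<Sum>i<n. r i - l i) < min d1 d2"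
    have "(\<Sum>i<n. norm (x (r i) - y (r i) - (x (l i) - y (l i))))
        \<le> (\<Sum>i<n. norm (x (r i) - x (l i)) + norm (y (r i) - y (l i)))"
      by (rule sum_mono) (metis diff_diff_eq2 diff_add_eq diff_diff_add add.commute norm_triangle_ineq4)
    also have "\<dots> < e"
      using d1[rule_format, of n l r] d2[rule_format, of n l r] A by (simp add: sum.distrib)
    finally show "(\<Sum>i<n. norm (x (r i) - y (r i) - (x (l i) - y (l i)))) < e" .
  qed
qed

lemma abs_cont_on_imp_continuous_on:
  assumes "abs_cont_on a b x"
  shows "continuous_on {a..b} x"
  unfolding continuous_on_iff
proof (intro ballI allI impI)
  fix s e :: real assume s: "s \<in> {a..b}" and "e > 0"
  obtain d where "d > 0" and
    d: "\<forall>(I :: unit set) l r. finite I \<and> (\<forall>i\<in>I. a \<le> l i \<and> l i \<le> r i \<and> r i \<le> b) \<and>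
      disjoint_family_on (\<lambda>i. {l i<..<r i}) I \<and> (\<Sum>i\<in>I. r i - l i) < d \<longrightarrow>
      (\<Sum>i\<in>I. norm (x (r i) - x (l i))) < e"
    using abs_cont_on_finite_index[OF assms \<open>e > 0\<close>] by blast
  have "dist (x t) (x s) < e" if "t \<in> {a..b}" "dist t s < d" for t
    \<comment> \<open>The family is the single interval between \<open>s\<close> and
      \<open>t\<close>, in whichever order they lie.\<close>
    using d[rule_format, of "{()}" "\<lambda>_. min s t" "\<lambda>_. max s t"] s that
    by (cases "s \<le> t") (auto simp: disjoint_family_on_def dist_norm norm_minus_commute)
  with \<open>d > 0\<close> show "\<exists>d>0. \<forall>t\<in>{a..b}. dist t s < d \<longrightarrow> dist (x t) (x s) < e" by blast
qed

section \<open>Uniqueness of solutions\<close>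

text \<open>The squared difference starts at 0 and has a nonpositive derivative almost everywhere.
  Allowing two domains \<open>I\<close> and \<open>J\<close> makes it possible to compare a solution
  on a bounded interval with a global one.\<close>

lemma is_solution_unique_if_dissipative:
  fixes f :: "real \<Rightarrow> real \<Rightarrow> real"
  assumes x: "is_solution f I x" and y: "is_solution f J y"
    and sub: "{a..b} \<subseteq> I" "{a..b} \<subseteq> J" and "a \<le> b" and init: "x a = y a"
    and f: "\<And>t v w. t \<in> {a..b} \<Longrightarrow> (v - w) * (f t v - f t w) \<le> 0"
  shows "x b = y b"
proof -
  let ?z = "\<lambda>t. x t - y t"
  have ac: "abs_cont_on a b ?z"
    using x y sub \<open>a \<le> b\<close> by (intro abs_cont_on_diff) (auto simp: is_solution_def)
  have "bounded (?z ` {a..b})"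
    by (intro compact_imp_bounded compact_continuous_image abs_cont_on_imp_continuous_on ac) auto
  then obtain B where B: "\<And>t. t \<in> {a..b} \<Longrightarrow> \<bar>?z t\<bar> \<le> B"
    unfolding bounded_iff by (metis imageI real_norm_def)
  have "B \<ge> 0" using B[of a] \<open>a \<le> b\<close> by auto
  \<comment> \<open>Squaring is Lipschitz only on bounded sets, hence the bound \<open>B\<close> on
    the difference of the solutions.\<close>
  have "(2 * B)-lipschitz_on {- B..B} (\<lambda>v::real. v\<^sup>2)"
  proof (rule lipschitz_onI)
    fix v w assume "v \<in> {- B..B}" "w \<in> {- B..B}"
    then have "\<bar>v + w\<bar> * \<bar>v - w\<bar> \<le> 2 * B * \<bar>v - w\<bar>" by (intro mult_right_mono) auto
    then show "dist (v\<^sup>2) (w\<^sup>2) \<le> 2 * B * dist v w"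
      by (simp add: dist_real_def abs_mult[symmetric] power2_eq_square algebra_simps)
  qed (use \<open>B \<ge> 0\<close> in auto)
  then have ac2: "abs_cont_on a b (\<lambda>t. (?z t)\<^sup>2)"
    by (rule lipschitz_on_abs_cont_on_compose[OF ac]) (use B in \<open>force simp: abs_le_iff\<close>)
  have "AE t in lebesgue. t \<in> {a..b} \<longrightarrow>
      (x has_vector_derivative f t (x t)) (at t within {a..b}) \<and>
      (y has_vector_derivative f t (y t)) (at t within {a..b})"
    using x[unfolded is_solution_def, THEN conjunct2] y[unfolded is_solution_def, THEN conjunct2]
    by eventually_elim (use sub in \<open>auto intro: has_vector_derivative_within_subset\<close>)
  then obtain N where N: "N \<in> null_sets lebesgue" and
    der: "\<And>t. t \<in> {a..b} - N \<Longrightarrow> (x has_vector_derivative f t (x t)) (at t within {a..b}) \<and>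
      (y has_vector_derivative f t (y t)) (at t within {a..b})"
    by (elim AE_E3) auto
  have "((\<lambda>t. 2 * (?z t * (f t (x t) - f t (y t)))) has_integral (?z b)\<^sup>2 - (?z a)\<^sup>2) {a..b}"
  proof (rule abs_cont_on_fundamental_theorem_of_calculus[OF \<open>a \<le> b\<close> ac2])
    show "negligible N" using N negligible_iff_null_sets by blast
    fix t assume "t \<in> {a..b} - N"
    from der[OF this] show "((\<lambda>t. (?z t)\<^sup>2) has_vector_derivative
        2 * (?z t * (f t (x t) - f t (y t)))) (at t within {a..b})"
      unfolding has_real_derivative_iff_has_vector_derivative[symmetric]
      by (auto intro!: derivative_eq_intros)
  qed
  then have "(?z b)\<^sup>2 - (?z a)\<^sup>2 \<le> 0"
  proof (rule has_integral_le[OF _ has_integral_0])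
    show "2 * (?z t * (f t (x t) - f t (y t))) \<le> 0" if "t \<in> {a..b}" for t
      using f[OF that, of "x t" "y t"] by simp
  qed
  with init show ?thesis by simp
qed

section \<open>Piecewise continuous functions\<close>

text \<open>One-sided limits bound \<open>u\<close> on both sides of each point, the value at the
  point bounds it there, and compactness reduces these local bounds to finitely many.\<close>

lemma piecewise_continuous_bounded:
  fixes u :: "real \<Rightarrow> 'a::real_normed_vector"
  assumes "piecewise_continuous u"
  obtains B where "B \<ge> 0" "\<And>t. t \<in> {0..b} \<Longrightarrow> norm (u t) \<le> B"
proof -
  have lim: "\<exists>l. (u \<longlongrightarrow> l) (at_right t)" if "t \<ge> 0" for t
    using assms that by (simp add: piecewise_continuous_def)
  have lim': "\<exists>l. (u \<longlongrightarrow> l) (at_left t)" if "t > 0" for t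
    using assms that by (simp add: piecewise_continuous_def)
  have loc: "\<exists>d>0. \<exists>B. \<forall>s\<ge>0. \<bar>s - t\<bar> < d \<longrightarrow> norm (u s) \<le> B" if "t \<in> {0..b}" for t
  proof -
    obtain l where "(u \<longlongrightarrow> l) (at_right t)"
      using lim[of t] \<open>t \<in> {0..b}\<close> by auto
    then have "\<forall>\<^sub>F s in at_right t. norm (u s) < norm l + 1"
      by (intro order_tendstoD(2)[OF tendsto_norm]) auto
    then obtain r where r: "r > t" "\<And>s. t < s \<Longrightarrow> s < r \<Longrightarrow> norm (u s) < norm l + 1"
      unfolding eventually_at_right_field by blast
    obtain q m where q: "q < t" "\<And>s. 0 \<le> s \<Longrightarrow> q < s \<Longrightarrow> s < t \<Longrightarrow> norm (u s) < m"
    proof (cases "t = 0")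
      case True
      \<comment> \<open>At time 0 the left-hand condition is vacuous, since it concerns only
        \<open>s\<close> with \<open>0 \<le> s\<close> and \<open>s < 0\<close>.\<close>
      then show thesis using that[of "-1" 0] by auto
    next
      case False
      with \<open>t \<in> {0..b}\<close> obtain l where "(u \<longlongrightarrow> l) (at_left t)"
        using lim'[of t] by auto
      then have "\<forall>\<^sub>F s in at_left t. norm (u s) < norm l + 1"
        by (intro order_tendstoD(2)[OF tendsto_norm]) auto
      then show thesis
        unfolding eventually_at_left_field using that[of _ "norm l + 1"] by blast
    qed
    have "norm (u s) \<le> max (norm (u t)) (max (norm l + 1) m)"
      if "s \<ge> 0" "\<bar>s - t\<bar> < min (r - t) (t - q)" for s
      using r(2)[of s] q(2)[of s] that by (cases s t rule: linorder_cases) (auto simp: less_max_iff_disj le_max_iff_disj)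
    moreover have "min (r - t) (t - q) > 0" using r q by simp
    ultimately show ?thesis by blast
  qed
  then obtain d B where d: "\<And>t. t \<in> {0..b} \<Longrightarrow> d t > 0"
    and B: "\<And>t s. t \<in> {0..b} \<Longrightarrow> s \<ge> 0 \<Longrightarrow> \<bar>s - t\<bar> < d t \<Longrightarrow> norm (u s) \<le> B t"
    by metis
  obtain C where C: "C \<subseteq> {0..b}" "finite C" "{0..b} \<subseteq> (\<Union>t\<in>C. ball t (d t))"
  proof (rule compactE_image)
    show "{0..b} \<subseteq> (\<Union>t\<in>{0..b}. ball t (d t))" using d by force
  qed auto
  have "norm (u s) \<le> (\<Sum>t\<in>C. \<bar>B t\<bar>)" if s: "s \<in> {0..b}" for s
  proof -
    obtain t where t: "t \<in> C" "\<bar>s - t\<bar> < d t"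
      using s C by (force simp: dist_real_def abs_minus_commute)
    then have "norm (u s) \<le> \<bar>B t\<bar>" using B[of t s] s C by force
    also have "\<dots> \<le> (\<Sum>t\<in>C. \<bar>B t\<bar>)" by (rule member_le_sum) (use t C in auto)
    finally show ?thesis .
  qed
  moreover have "(\<Sum>t\<in>C. \<bar>B t\<bar>) \<ge> 0" by (simp add: sum_nonneg)
  ultimately show thesis using that by blast
qed

text \<open>Off the finite, hence negligible, set of discontinuities the function is continuous, so
  measurable, and it is dominated by a constant.\<close>

lemma piecewise_continuous_integrable_on:
  fixes u :: "real \<Rightarrow> 'a::euclidean_space"
  assumes u: "piecewise_continuous u" and "0 \<le> a"
  shows "u integrable_on {a..b}"
proof -
  define D where "D = {t \<in> {0..b}. \<not> continuous (at t within {0..}) u}"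
  have "finite D" using u by (auto simp: D_def piecewise_continuous_def)
  then have S: "{a..b} - D \<in> sets lebesgue" and neg: "negligible D"
    by (auto simp: negligible_finite intro!: sets.Diff[OF _ negligible_imp_sets])
  obtain B where B: "\<And>t. t \<in> {0..b} \<Longrightarrow> norm (u t) \<le> B"
    using piecewise_continuous_bounded[OF u, of b] by metis
  have "continuous_on ({a..b} - D) u"
    unfolding continuous_on_eq_continuous_within
  proof
    fix t assume "t \<in> {a..b} - D"
    then have "continuous (at t within {0..}) u" using \<open>0 \<le> a\<close> by (auto simp: D_def)
    then show "continuous (at t within {a..b} - D) u"
      by (rule continuous_within_subset) (use \<open>0 \<le> a\<close> in auto)
  qed
  then have "u integrable_on ({a..b} - D)"
  proof (rule measurable_bounded_by_integrable_imp_integrable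
      [OF continuous_imp_measurable_on_sets_lebesgue[OF _ S] _ _ S])
    have "(\<lambda>_. B) integrable_on {a..b}" by (rule integrable_const_ivl)
    then show "(\<lambda>_. B) integrable_on {a..b} - D"
      by (rule integrable_spike_set) (auto intro: negligible_subset[OF neg])
  qed (use B \<open>0 \<le> a\<close> in auto)
  then show ?thesis
    by (rule integrable_spike_set) (auto intro: negligible_subset[OF neg])
qed

lemma piecewise_continuous_compose:
  fixes u :: "real \<Rightarrow> 'a::topological_space" and g :: "'a \<Rightarrow> 'b::topological_space"
  assumes u: "piecewise_continuous u" and g: "continuous_on UNIV g"
  shows "piecewise_continuous (\<lambda>t. g (u t))"
  unfolding piecewise_continuous_def
proof (intro conjI allI impI)
  have g': "((\<lambda>t. g (u t)) \<longlongrightarrow> g l) F" if "(u \<longlongrightarrow> l) F" for l F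
    using continuous_on_tendsto_compose[OF g that] by simp
  fix t b :: real
  have "{t \<in> {0..b}. \<not> continuous (at t within {0..}) (\<lambda>t. g (u t))}
      \<subseteq> {t \<in> {0..b}. \<not> continuous (at t within {0..}) u}"
    using g' by (auto simp: continuous_within)
  then show "finite {t \<in> {0..b}. \<not> continuous (at t within {0..}) (\<lambda>t. g (u t))}"
    using u by (auto simp: piecewise_continuous_def intro: finite_subset)
  show "\<exists>l. ((\<lambda>t. g (u t)) \<longlongrightarrow> l) (at_right t)" if "t \<ge> 0"
    using u g' that by (meson piecewise_continuous_def)
  show "\<exists>l. ((\<lambda>t. g (u t)) \<longlongrightarrow> l) (at_left t)" if "t > 0"
    using u g' that by (meson piecewise_continuous_def)
qed

text \<open>The discontinuities on the half-line are a countable union of finite sets.\<close>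

lemma piecewise_continuous_AE_continuous:
  assumes "piecewise_continuous u"
  shows "AE t in lebesgue. t \<ge> 0 \<longrightarrow> continuous (at t within {0..}) u"
proof (rule AE_I)
  let ?D = "{t. \<not> (t \<ge> 0 \<longrightarrow> continuous (at t within {0..}) u)}"
  have D: "?D = (\<Union>n::nat. {t \<in> {0..real n}. \<not> continuous (at t within {0..}) u})"
    using real_arch_simple by auto
  have "countable ?D"
    unfolding D using assms
    by (intro countable_UN) (auto intro: countable_finite simp: piecewise_continuous_def)
  then have "?D \<in> null_sets lebesgue"
    by (intro null_sets_completionI countable_imp_null_set_lborel)
  then show "emeasure lebesgue ?D = 0" "?D \<in> sets lebesgue" by auto
qed auto

text \<open>Convexity puts the power above its tangent at \<open>y\<close>; integrated, this yields
  Jensen's inequality. Convexity is used on the open half-line, so \<open>x = 0\<close> is separate: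
  there the tangent takes the value \<open>- (q - 1) * y powr q\<close>.\<close>

lemma powr_ge_tangent:
  fixes x y q :: real
  assumes "x \<ge> 0" "y > 0" "q \<ge> 1"
  shows "x powr q \<ge> y powr q + q * y powr (q - 1) * (x - y)"
proof (cases "x = 0")
  case True
  have "y powr q = y powr (q - 1) * y"
    using \<open>y > 0\<close> powr_add[of y "q - 1" 1] by simp
  then have "y powr q + q * y powr (q - 1) * (x - y) = - ((q - 1) * (y powr (q - 1) * y))"
    by (simp add: True algebra_simps)
  also have "\<dots> \<le> 0" using assms by simp
  finally show ?thesis using True by simp
next
  case False
  have "x powr q - y powr q \<ge> (q * y powr (q - 1)) * (x - y)"
  proof (rule convex_on_imp_above_tangent[OF powr_convex[OF \<open>q \<ge> 1\<close>]])
    show "((\<lambda>x. x powr q) has_field_derivative q * y powr (q - 1)) (at y within {0<..})"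
      using \<open>y > 0\<close> by (intro DERIV_subset[OF has_real_derivative_powr]) auto
  qed (use assms False in \<open>auto simp: interior_open\<close>)
  then show ?thesis by simp
qed

section \<open>The scalar system\<close>

lemma spow_mono:
  assumes "p > 0" "v \<le> w"
  shows "spow v p \<le> spow w p"
proof -
  consider "0 \<le> v" | "v < 0" "0 \<le> w" | "w < 0" by linarith
  then show ?thesis
  proof cases
    case 1
    then have "v powr p \<le> w powr p" using assms by (intro powr_mono2) auto
    then show ?thesis using 1 assms by (auto simp: spow_def sgn_if)
  next
    case 2
    then show ?thesis
      using order_trans[of "- ((- v) powr p)" 0 "w powr p"] by (auto simp: spow_def sgn_if)
  next
    case 3
    then have "(- w) powr p \<le> (- v) powr p" using assms by (intro powr_mono2) auto
    then show ?thesis using 3 assms by (auto simp: spow_def sgn_if)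
  qed
qed

text \<open>The outer factor \<open>k\<close> is absorbed into \<open>v - w\<close>, which leaves
  monotonicity of the signed power, whatever the sign of \<open>k\<close>.\<close>

lemma feedback_dissipative:
  assumes "p > 0"
  shows "(v - w) * ((- spow (k * v) p * k) - (- spow (k * w) p * k)) \<le> 0"
proof -
  have "(k * v - k * w) * (spow (k * v) p - spow (k * w) p) \<ge> 0"
    using spow_mono[OF assms] by (cases "k * v \<le> k * w") (auto intro: mult_nonpos_nonpos)
  then show ?thesis by (simp add: algebra_simps)
qed

text \<open>This separates the variables: one factor depends on the state alone, the other on the
  input alone.\<close>

lemma feedback_eq: "- spow (k * x) p * k = - (sgn x * \<bar>x\<bar> powr p * \<bar>k\<bar> powr (p + 1))"
proof -
  have "\<bar>k\<bar> powr (p + 1) = \<bar>k\<bar> powr p * \<bar>k\<bar>"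
    by (cases "k = 0") (simp_all add: powr_add)
  moreover have "\<bar>k\<bar> = sgn k * k" by (simp add: abs_sgn)
  ultimately show ?thesis
    by (simp add: spow_def abs_mult powr_mult sgn_mult)
qed

text \<open>The energy acts as a new clock: measured by it instead of \<open>t\<close>, the system
  becomes the autonomous equation \<open>x' = - spow x p\<close>.\<close>

definition energy :: "(real \<Rightarrow> real) \<Rightarrow> real \<Rightarrow> real \<Rightarrow> real \<Rightarrow> real" where
  "energy u p t0 t = integral {t0..t} (\<lambda>s. \<bar>u s\<bar> powr (p + 1))"

text \<open>On nonzero solutions the equation says that \<open>\<bar>x\<bar> powr (1 - p)\<close> grows at the rate
  \<open>(p - 1) * \<bar>u\<bar> powr (p + 1)\<close>.\<close>

definition trajectory :: "(real \<Rightarrow> real) \<Rightarrow> real \<Rightarrow> real \<Rightarrow> real \<Rightarrow> real \<Rightarrow> real" where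
  "trajectory u p t0 x0 t =
     sgn x0 * (\<bar>x0\<bar> powr (1 - p) + (p - 1) * energy u p t0 t) powr (- 1 / (p - 1))"

lemma trajectory_initial:
  assumes "p > 1"
  shows "trajectory u p t0 x0 t0 = x0"
proof (cases "x0 = 0")
  case False
  have "(1 - p) * (- 1 / (p - 1)) = 1" using assms by (simp add: field_simps)
  then show ?thesis using False
    by (simp add: trajectory_def energy_def powr_powr sgn_mult_abs)
qed (simp add: trajectory_def)

section \<open>Explicit solutions\<close>

context
  fixes u :: "real \<Rightarrow> real" and p :: real
  assumes u: "piecewise_continuous u" and p: "p > 1"
begin

lemma piecewise_continuous_power: "piecewise_continuous (\<lambda>t. \<bar>u t\<bar> powr (p + 1))"
  by (rule piecewise_continuous_compose[OF u, of "\<lambda>w. \<bar>w\<bar> powr (p + 1)"])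
    (use p in \<open>auto intro!: continuous_on_powr' continuous_on_rabs continuous_on_id continuous_on_const\<close>)

lemma power_integrable_on: "0 \<le> a \<Longrightarrow> (\<lambda>t. \<bar>u t\<bar> powr (p + 1)) integrable_on {a..b}"
  by (rule piecewise_continuous_integrable_on[OF piecewise_continuous_power])

lemma energy_diff:
  assumes "0 \<le> t0" "t0 \<le> s" "s \<le> t"
  shows "energy u p t0 t = energy u p t0 s + energy u p s t"
  unfolding energy_def
  using Henstock_Kurzweil_Integration.integral_combine[of t0 s t "\<lambda>t. \<bar>u t\<bar> powr (p + 1)"]
    assms power_integrable_on[of t0 t] by simp

lemma energy_nonneg: "0 \<le> energy u p t0 t"
  unfolding energy_def
  \<comment> \<open>A negative \<open>t0\<close> is allowed here, so integrability may fail;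
    \<open>integral\<close> then has the default value 0.\<close>
  by (cases "(\<lambda>s. \<bar>u s\<bar> powr (p + 1)) integrable_on {t0..t}")
    (auto intro: integral_nonneg simp: not_integrable_integral)

text \<open>The integrand is bounded on \<open>{0..b}\<close>, so its integral grows at most
  linearly there.\<close>

lemma energy_lipschitz:
  assumes "0 \<le> t0" "t0 \<le> a"
  shows "\<exists>L. L-lipschitz_on {a..b} (energy u p t0)"
proof -
  obtain B where B: "B \<ge> 0" "\<And>t. t \<in> {0..b} \<Longrightarrow> norm (\<bar>u t\<bar> powr (p + 1)) \<le> B"
    using piecewise_continuous_bounded[OF piecewise_continuous_power] by metis
  have est: "dist (energy u p t0 r) (energy u p t0 l) \<le> B * dist r l"
    if "l \<in> {a..b}" "r \<in> {a..b}" "l \<le> r" for l r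
  proof -
    have "norm (energy u p l r) \<le> B * (r - l)"
      using integral_norm_bound_integral[OF power_integrable_on integrable_const_ivl, of l r B]
        that assms B(2) by (auto simp: energy_def mult.commute)
    then show ?thesis
      using energy_diff[of t0 l r] that assms by (simp add: dist_real_def)
  qed
  have "B-lipschitz_on {a..b} (energy u p t0)"
    by (rule lipschitz_onI) (use est B(1) in \<open>metis dist_commute linear\<close>, fact)
  then show ?thesis ..
qed

lemma energy_has_real_derivative:
  assumes "0 \<le> t0" "t0 \<le> t" "continuous (at t within {0..}) u"
  shows "(energy u p t0 has_real_derivative \<bar>u t\<bar> powr (p + 1)) (at t within {t0..})"
proof -
  have "continuous (at t within {0..}) (\<lambda>t. \<bar>u t\<bar> powr (p + 1))"
    using assms(3) p unfolding continuous_within by (intro tendsto_powr' tendsto_intros) auto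
  \<comment> \<open>The endpoint \<open>t + 1\<close> leaves room to the right of \<open>t\<close>,
    so that the derivative carries over to the half-line. The difference with \<open>{}\<close>
    matches the form of the rule applied next.\<close>
  then have "continuous (at t within {t0..t + 1} - {}) (\<lambda>t. \<bar>u t\<bar> powr (p + 1))"
    by (rule continuous_within_subset) (use assms in auto)
  from integral_has_vector_derivative_continuous_at[OF power_integrable_on[OF assms(1)] _ _ this]
  have "(energy u p t0 has_real_derivative \<bar>u t\<bar> powr (p + 1)) (at t within {t0..t + 1})"
    using assms by (simp add: energy_def[abs_def] has_real_derivative_iff_has_vector_derivative)
  moreover have "at t within {t0..} = at t within {t0..t + 1}"
    by (rule at_within_nhd[of t "{..<t + 1}"]) auto
  ultimately show ?thesis by simp
qed

text \<open>With \<open>s\<close> as the clock, the power law solves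
  \<open>x' = - (x powr p)\<close>: the exponent on the right is \<open>p\<close> times the one on
  the left.\<close>

lemma power_law_derivative:
  assumes "k > 0" "s \<ge> 0"
  shows "((\<lambda>s. (k + (p - 1) * s) powr (- 1 / (p - 1))) has_real_derivative
    - ((k + (p - 1) * s) powr (- p / (p - 1)))) (at s within S)"
proof -
  have pos: "k + (p - 1) * s > 0" using assms p by (simp add: add_pos_nonneg)
  have e: "- 1 / (p - 1) - 1 = - p / (p - 1)" using p by (simp add: field_simps)
  have D1: "((\<lambda>z. z powr (- 1 / (p - 1))) has_real_derivative
      - 1 / (p - 1) * (k + (p - 1) * s) powr (- p / (p - 1))) (at (k + (p - 1) * s))"
    using has_real_derivative_powr[OF pos, of "- 1 / (p - 1)"] unfolding e .
  have D2: "((\<lambda>s. k + (p - 1) * s) has_real_derivative (p - 1)) (at s within S)"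
    by (auto intro!: derivative_eq_intros)
  have "- 1 / (p - 1) * w * (p - 1) = - w" for w using p by simp
  then show ?thesis using DERIV_chain2[OF D1 D2] by (simp only:)
qed

text \<open>The derivative is largest in absolute value at \<open>s = 0\<close>, where the base
  equals \<open>k\<close>.\<close>

lemma power_law_lipschitz:
  assumes "k > 0"
  shows "(k powr (- p / (p - 1)))-lipschitz_on {0..} (\<lambda>s. (k + (p - 1) * s) powr (- 1 / (p - 1)))"
proof (rule lipschitz_onI)
  fix v w :: real assume vw: "v \<in> {0..}" "w \<in> {0..}"
  let ?f = "\<lambda>s. (k + (p - 1) * s) powr (- 1 / (p - 1))"
  have "norm (?f v - ?f w) \<le> k powr (- p / (p - 1)) * norm (v - w)"
  proof (rule field_differentiable_bound[of "{0..}"])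
    fix s :: real assume "s \<in> {0..}"
    then show "(?f has_real_derivative - ((k + (p - 1) * s) powr (- p / (p - 1)))) (at s within {0..})"
      using power_law_derivative assms by simp
    show "norm (- ((k + (p - 1) * s) powr (- p / (p - 1)))) \<le> k powr (- p / (p - 1))"
      using \<open>s \<in> {0..}\<close> assms p by (auto intro!: powr_mono2' simp: divide_nonpos_pos)
  qed (use vw in auto)
  then show "dist (?f v) (?f w) \<le> k powr (- p / (p - 1)) * dist v w" by (simp add: dist_norm)
qed simp

text \<open>For \<open>x0\<close> nonzero the trajectory is a composition of Lipschitz maps, hence
  absolutely continuous, and the chain rule gives the equation wherever \<open>u\<close> is
  continuous.\<close>

lemma trajectory_is_solution:
  assumes "0 \<le> t0"
  shows "is_solution (\<lambda>t x. - spow (u t * x) p * u t) {t0..} (trajectory u p t0 x0)"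
proof (cases "x0 = 0")
  case True
  then have "trajectory u p t0 x0 = (\<lambda>_. 0)" by (auto simp: trajectory_def)
  then show ?thesis by (simp add: is_solution_def abs_cont_on_def spow_def exI[of _ 1])
next
  case False
  let ?k = "\<bar>x0\<bar> powr (1 - p)"
  let ?f = "\<lambda>s. (?k + (p - 1) * s) powr (- 1 / (p - 1))"
  have k: "?k > 0" using False by simp
  have X: "trajectory u p t0 x0 = (\<lambda>t. sgn x0 * ?f (energy u p t0 t))"
    by (auto simp: trajectory_def)
  show ?thesis
    unfolding is_solution_def
  proof (intro conjI allI impI)
    fix a b :: real assume ab: "a \<le> b \<and> {a..b} \<subseteq> {t0..}"
    then have "t0 \<le> a" by auto
    then obtain L where "L-lipschitz_on {a..b} (energy u p t0)"
      using energy_lipschitz assms by blast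
    then have "abs_cont_on a b (\<lambda>t. ?f (energy u p t0 t))"
      by (intro lipschitz_on_abs_cont_on_compose[OF lipschitz_on_imp_abs_cont_on power_law_lipschitz[OF k]])
        (auto simp: energy_nonneg)
    then show "abs_cont_on a b (trajectory u p t0 x0)"
      unfolding X
      by (rule lipschitz_on_abs_cont_on_compose[where L = "\<bar>sgn x0\<bar>" and S = UNIV])
        (auto intro!: lipschitz_onI simp: dist_real_def sgn_if)
  next
    show "AE t in lebesgue. t \<in> {t0..} \<longrightarrow> (trajectory u p t0 x0 has_vector_derivative
        - spow (u t * trajectory u p t0 x0 t) p * u t) (at t within {t0..})"
      using piecewise_continuous_AE_continuous[OF u]
    proof eventually_elim
      case (elim t)
      show ?case
      proof
        assume "t \<in> {t0..}"
        then have t: "t0 \<le> t" "continuous (at t within {0..}) u" using elim assms by auto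
        let ?z = "?k + (p - 1) * energy u p t0 t"
        have z: "?z > 0" using k p energy_nonneg by (simp add: add_pos_nonneg)
        have "(trajectory u p t0 x0 has_real_derivative
            sgn x0 * (- (?z powr (- p / (p - 1))) * \<bar>u t\<bar> powr (p + 1))) (at t within {t0..})"
          unfolding X
          by (intro DERIV_cmult DERIV_chain2[where f = ?f] power_law_derivative k energy_nonneg
              energy_has_real_derivative assms t)
        moreover have "\<bar>trajectory u p t0 x0 t\<bar> powr p = ?z powr (- p / (p - 1))"
          using False z by (simp add: trajectory_def abs_mult powr_powr)
        moreover have "sgn (trajectory u p t0 x0 t) = sgn x0"
          using z by (simp add: trajectory_def sgn_mult)
        ultimately show "(trajectory u p t0 x0 has_vector_derivative
            - spow (u t * trajectory u p t0 x0 t) p * u t) (at t within {t0..})"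
          unfolding feedback_eq has_real_derivative_iff_has_vector_derivative by (simp add: mult.assoc)
      qed
    qed
  qed
qed

text \<open>Uniqueness against the explicit solution. The domain \<open>I\<close> stays general so
  that solutions on \<open>{t0..<b}\<close> are covered too.\<close>

lemma solution_eq_trajectory:
  assumes "is_solution (\<lambda>t x. - spow (u t * x) p * u t) I x" "0 \<le> t0" "t0 \<le> t" "{t0..t} \<subseteq> I"
  shows "x t = trajectory u p t0 (x t0) t"
proof (rule is_solution_unique_if_dissipative[OF assms(1) trajectory_is_solution[OF assms(2)] assms(4)])
  show "x t0 = trajectory u p t0 (x t0) t0" using trajectory_initial p by simp
qed (use assms feedback_dissipative[of p] p in auto)

lemma abs_trajectory_mono:
  assumes "0 \<le> t0" "t0 \<le> s" "s \<le> t"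
  shows "\<bar>trajectory u p t0 x0 t\<bar> \<le> \<bar>trajectory u p t0 x0 s\<bar>"
proof (cases "x0 = 0")
  case False
  then show ?thesis
    using energy_diff[OF assms] energy_nonneg p
    by (auto simp: trajectory_def abs_mult add_pos_nonneg divide_nonpos_pos intro!: powr_mono2')
qed (simp add: trajectory_def)

lemma abs_trajectory_le_initial:
  assumes "0 \<le> t0" "t0 \<le> t"
  shows "\<bar>trajectory u p t0 x0 t\<bar> \<le> \<bar>x0\<bar>"
  using abs_trajectory_mono[OF assms(1) order_refl assms(2), of x0] trajectory_initial[OF p] by simp

section \<open>Persistent excitation and the settling time\<close>

text \<open>The tangent to the power \<open>p + 1\<close> at \<epsilon> is integrated over one
  period. Excitation bounds the integral of \<open>\<bar>u s\<bar>\<close> below by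
  \<open>T * \<epsilon>\<close>, and then the terms with factor \<open>p + 1\<close> cancel.\<close>

lemma energy_period_ge:
  assumes pe: "persistently_exciting T \<epsilon> u" and "0 \<le> t"
  shows "T * \<epsilon> powr (p + 1) \<le> energy u p t (t + T)"
proof -
  have T: "T > 0" "\<epsilon> > 0"
    \<comment> \<open>In dimension one the unit vector 1 turns the inner product into
      \<open>u s\<close> itself.\<close>
    and "norm (1 :: real) = 1 \<longrightarrow> \<epsilon> \<le> 1 / T * integral {t..t + T} (\<lambda>s. \<bar>u s \<bullet> 1\<bar>)"
    using pe \<open>0 \<le> t\<close> unfolding persistently_exciting_def by blast+
  then have I: "T * \<epsilon> \<le> integral {t..t + T} (\<lambda>s. \<bar>u s\<bar>)" by (simp add: field_simps)
  have int: "(\<lambda>s. \<bar>u s\<bar>) integrable_on {t..t + T}"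
    using \<open>0 \<le> t\<close> by (intro piecewise_continuous_integrable_on piecewise_continuous_compose[OF u])
      (auto intro: continuous_intros)
  let ?g = "\<lambda>s. (\<epsilon> powr (p + 1) - (p + 1) * \<epsilon> powr p * \<epsilon>) + (p + 1) * \<epsilon> powr p * \<bar>u s\<bar>"
  have "(?g has_integral (\<epsilon> powr (p + 1) - (p + 1) * \<epsilon> powr p * \<epsilon>) * T +
      (p + 1) * \<epsilon> powr p * integral {t..t + T} (\<lambda>s. \<bar>u s\<bar>)) {t..t + T}"
    using has_integral_const_real[of "\<epsilon> powr (p + 1) - (p + 1) * \<epsilon> powr p * \<epsilon>" t "t + T"] T
    by (intro has_integral_add has_integral_mult_right integrable_integral int) (simp add: mult.commute)
  moreover have "((\<lambda>s. \<bar>u s\<bar> powr (p + 1)) has_integral energy u p t (t + T)) {t..t + T}"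
    unfolding energy_def using power_integrable_on[OF \<open>0 \<le> t\<close>] by (rule integrable_integral)
  ultimately have "(\<epsilon> powr (p + 1) - (p + 1) * \<epsilon> powr p * \<epsilon>) * T +
      (p + 1) * \<epsilon> powr p * integral {t..t + T} (\<lambda>s. \<bar>u s\<bar>) \<le> energy u p t (t + T)"
  proof (rule has_integral_le)
    show "?g s \<le> \<bar>u s\<bar> powr (p + 1)" for s
      using powr_ge_tangent[of "\<bar>u s\<bar>" \<epsilon> "p + 1"] T p by (simp add: algebra_simps)
  qed
  moreover have "(p + 1) * \<epsilon> powr p * (T * \<epsilon>) \<le> (p + 1) * \<epsilon> powr p * integral {t..t + T} (\<lambda>s. \<bar>u s\<bar>)"
    using I p by (intro mult_left_mono) auto
  ultimately show ?thesis by (simp add: algebra_simps)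
qed

lemma energy_periods_ge:
  assumes "persistently_exciting T \<epsilon> u" "0 \<le> t"
  shows "real n * T * \<epsilon> powr (p + 1) \<le> energy u p t (t + real n * T)"
proof (induction n)
  case 0
  then show ?case by (simp add: energy_def)
next
  case (Suc n)
  have "T > 0" using assms by (simp add: persistently_exciting_def)
  then have "energy u p t (t + real (Suc n) * T) =
      energy u p t (t + real n * T) + energy u p (t + real n * T) (t + real n * T + T)"
    using energy_diff[of t "t + real n * T" "t + real (Suc n) * T"] assms
    by (simp add: algebra_simps)
  then show ?case
    using Suc energy_period_ge[OF assms(1), of "t + real n * T"] assms \<open>T > 0\<close>
    by (simp add: algebra_simps)
qed

text \<open>The bound holds at every time after \<open>n\<close> periods, not just at one, so it
  serves attractivity as well as the escape time.\<close>

lemma V_trajectory_le: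
  assumes pe: "persistently_exciting T \<epsilon> u" and "0 \<le> t0" "c > 0" "t0 + real n * T \<le> t"
    and n: "1 / (2 powr ((p - 1) / 2) * (p - 1) * T * \<epsilon> powr (p + 1))
              * (1 / c powr ((p - 1) / 2)) \<le> real n"
  shows "V (trajectory u p t0 x0 t) \<le> c"
proof (cases "x0 = 0")
  case True
  then show ?thesis using \<open>c > 0\<close> by (simp add: trajectory_def V_def)
next
  case False
  have T: "T > 0" "\<epsilon> > 0" using pe by (auto simp: persistently_exciting_def)
  let ?z = "\<bar>x0\<bar> powr (1 - p) + (p - 1) * energy u p t0 t"
  \<comment> \<open>This is the value of \<open>\<bar>x\<bar> powr (1 - p)\<close> on the boundary
    \<open>V x = c\<close>, where \<open>\<bar>x\<bar> = sqrt (2 * c)\<close>.\<close>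
  have "(2 * c) powr (- ((p - 1) / 2)) = 1 / (2 powr ((p - 1) / 2) * c powr ((p - 1) / 2))"
    using \<open>c > 0\<close> by (simp add: powr_minus powr_mult divide_simps)
  also have "\<dots> \<le> (p - 1) * (real n * T * \<epsilon> powr (p + 1))"
    using n p T \<open>c > 0\<close> by (simp add: field_simps)
  also have "\<dots> \<le> (p - 1) * energy u p t0 (t0 + real n * T)"
    using energy_periods_ge[OF pe \<open>0 \<le> t0\<close>] p by (intro mult_left_mono) auto
  also have "\<dots> \<le> (p - 1) * energy u p t0 t"
    using energy_diff[of t0 "t0 + real n * T" t] energy_nonneg p T assms by (intro mult_left_mono) auto
  \<comment> \<open>Dropping the nonnegative initial term makes the estimate independent of
    \<open>x0\<close>. The negative exponent applied next reverses the inequality.\<close>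
  also have "\<dots> \<le> ?z" by simp
  finally have "?z powr (- 1 / (p - 1)) \<le> ((2 * c) powr (- ((p - 1) / 2))) powr (- 1 / (p - 1))"
    using p \<open>c > 0\<close> by (intro powr_mono2') (auto simp: divide_nonpos_pos)
  also have "\<dots> = (2 * c) powr (1 / 2)"
  proof -
    have "- ((p - 1) / 2) * (- 1 / (p - 1)) = 1 / 2" using p by simp
    then show ?thesis by (simp only: powr_powr)
  qed
  also have "\<dots> = sqrt (2 * c)"
    using \<open>c > 0\<close> by (simp add: powr_half_sqrt)
  finally have "\<bar>trajectory u p t0 x0 t\<bar> \<le> sqrt (2 * c)"
    using False by (simp add: trajectory_def abs_mult)
  then have "(trajectory u p t0 x0 t)\<^sup>2 \<le> 2 * c"
    by (metis abs_le_square_iff abs_ge_zero abs_of_nonneg order_trans real_sqrt_pow2_iff real_sqrt_ge_0_iff)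
  then show ?thesis by (simp add: V_def)
qed

end

theorem theorem2:
  fixes u :: "real \<Rightarrow> real" and T \<epsilon> p :: real
  assumes "piecewise_continuous u"
    and "persistently_exciting T \<epsilon> u"
    and "p > 1"
  shows "globally_uniformly_asymptotically_stable (\<lambda>t x. - spow (u t * x) p * u t) \<and>
    (\<forall>c>0. \<forall>t0\<ge>0. \<forall>x. is_solution (\<lambda>t x. - spow (u t * x) p * u t) {t0..} x \<longrightarrow>
      (\<exists>t\<ge>t0.
         t - t0 \<le> of_int \<lceil>1 / (2 powr ((p - 1) / 2) * (p - 1) * T * \<epsilon> powr (p + 1))
                          * (1 / c powr ((p - 1) / 2))\<rceil> * T
         \<and> V (x t) \<le> c))"
proof -
  let ?f = "\<lambda>t x. - spow (u t * x) p * u t"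
  define Q where "Q c = 1 / (2 powr ((p - 1) / 2) * (p - 1) * T * \<epsilon> powr (p + 1))
                          * (1 / c powr ((p - 1) / 2))" for c
  have T: "T > 0" using assms(2) by (simp add: persistently_exciting_def)
  have "Q c \<ge> 0" for c using T \<open>p > 1\<close> by (simp add: Q_def)
  \<comment> \<open>As \<open>Q c\<close> is nonnegative, \<open>nat\<close> does not truncate the
    ceiling, which becomes the number of full periods.\<close>
  then have n: "real (nat \<lceil>Q c\<rceil>) = of_int \<lceil>Q c\<rceil>" "Q c \<le> real (nat \<lceil>Q c\<rceil>)" for c
    by (auto simp: real_nat_ceiling_ge)
  have nn: "0 \<le> of_int \<lceil>Q c\<rceil> * T" for c
    using T n(1)[of c] by (metis mult_nonneg_nonneg of_nat_0_le_iff order_less_imp_le)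
  have sol: "x t = trajectory u p t0 (x t0) t" if "is_solution ?f {t0..} x" "0 \<le> t0" "t0 \<le> t" for x t0 t
    using solution_eq_trajectory[OF assms(1,3) that] by auto
  have decay: "\<bar>x t\<bar> \<le> \<bar>x t0\<bar>" if "is_solution ?f {t0..} x" "0 \<le> t0" "t0 \<le> t" for x t0 t
    using sol[OF that] abs_trajectory_le_initial[OF assms(1,3) that(2,3)] by metis
  have reach: "V (x t) \<le> c"
    if "is_solution ?f {t0..} x" "0 \<le> t0" "c > 0" "t0 + of_int \<lceil>Q c\<rceil> * T \<le> t" for x t0 t c
  proof -
    have "t0 \<le> t" using nn[of c] that(4) by linarith
    moreover have "V (trajectory u p t0 (x t0) t) \<le> c"
      using V_trajectory_le[OF assms(1,3,2) that(2,3), of "nat \<lceil>Q c\<rceil>" t] that(4) n[of c]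
      by (simp add: Q_def)
    ultimately show ?thesis using sol[OF that(1,2)] by metis
  qed
  have "forward_complete ?f"
    unfolding forward_complete_def
  proof (intro conjI allI impI)
    fix t0 x0 :: real assume "0 \<le> t0"
    then show "\<exists>x. is_solution ?f {t0..} x \<and> x t0 = x0"
      using trajectory_is_solution[OF assms(1,3)] trajectory_initial[OF assms(3)]
      by (intro exI[of _ "trajectory u p t0 x0"]) simp
  next
    fix t0 b :: real and x assume "0 \<le> t0" "b > t0" and x: "is_solution ?f {t0..<b} x"
    \<comment> \<open>The explicit global solution is the required extension; agreement is checked
      on each compact \<open>{t0..t}\<close>.\<close>
    have "trajectory u p t0 (x t0) t = x t" if "t \<in> {t0..<b}" for t
    proof -
      have "{t0..t} \<subseteq> {t0..<b}" using that by auto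
      then show ?thesis
        using solution_eq_trajectory[OF assms(1,3) x \<open>0 \<le> t0\<close>, of t] that by simp
    qed
    then show "\<exists>y. is_solution ?f {t0..} y \<and> (\<forall>t\<in>{t0..<b}. y t = x t)"
      using trajectory_is_solution[OF assms(1,3) \<open>0 \<le> t0\<close>]
      by (intro exI[of _ "trajectory u p t0 (x t0)"]) simp
  qed
  \<comment> \<open>Since \<open>\<bar>x t\<bar>\<close> never exceeds
    \<open>\<bar>x t0\<bar>\<close>, the witnesses \<open>d = e\<close> and \<open>R = r\<close>
    suffice.\<close>
  moreover have "uniformly_stable ?f" "uniformly_bounded ?f"
    unfolding uniformly_stable_def uniformly_bounded_def real_norm_def
    by (intro allI impI exI conjI; use decay order_le_less_trans in blast)+
  moreover have "uniformly_globally_attractive ?f"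
    unfolding uniformly_globally_attractive_def
  proof (intro allI impI)
    fix r e :: real assume "r > 0" "e > 0"
    \<comment> \<open>The level \<open>e\<^sup>2 / 8\<close> of \<open>V\<close> corresponds to
      \<open>\<bar>x t\<bar> \<le> e / 2\<close>, which makes the bound by \<open>e\<close> strict.
      The waiting time depends on \<open>e\<close> but not on \<open>r\<close>.\<close>
    have "norm (x t) < e"
      if "0 \<le> t0" "is_solution ?f {t0..} x" "t0 + of_int \<lceil>Q (e\<^sup>2 / 8)\<rceil> * T \<le> t" for x t0 t
    proof -
      have "V (x t) \<le> e\<^sup>2 / 8"
        using reach[OF that(2,1) _ that(3)] \<open>e > 0\<close> by simp
      then have "\<bar>x t\<bar>\<^sup>2 \<le> (e / 2)\<^sup>2" by (simp add: V_def power_divide)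
      then have "\<bar>x t\<bar> \<le> e / 2" by (rule power2_le_imp_le) (use \<open>e > 0\<close> in simp)
      then show ?thesis using \<open>e > 0\<close> by simp
    qed
    with nn show "\<exists>S\<ge>0. \<forall>t0\<ge>0. \<forall>x. is_solution ?f {t0..} x \<and> norm (x t0) < r \<longrightarrow>
        (\<forall>t\<ge>t0 + S. norm (x t) < e)" by blast
  qed
  moreover have "\<exists>t\<ge>t0. t - t0 \<le> of_int \<lceil>Q c\<rceil> * T \<and> V (x t) \<le> c"
    if "c > 0" "0 \<le> t0" "is_solution ?f {t0..} x" for c t0 x
    using reach[OF that(3,2,1) order_refl] nn[of c]
    \<comment> \<open>The latest admissible time serves as the witness.\<close>
    by (intro exI[of _ "t0 + of_int \<lceil>Q c\<rceil> * T"]) simp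
  ultimately show ?thesis
    unfolding globally_uniformly_asymptotically_stable_def Q_def by blast
qed

end
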